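(* Let $s\ge 1$. The set $\Sigma^{s}$ with the addition $\oplus$ and the multiplication $\otimes$ forms a commutative $n$i-signed-ring $(\Sigma^{s},\oplus,\otimes)$, with $n=s-1$.
   Context: **Magnitudes.** $P$ is a non-empty set with two binary operations $+$ and $\cdot$ such that: $(P,+)$ is a commutative monoid with identity $0$; $(P\setminus\{0\},\cdot)$ is an abelian group (its identity is written $1$); and $\cdot$ distributes over $+$ on both sides. Moreover $(P,+,\le)$ is a totally ordered (with translation-invariant order) cancellative commutative monoid, such that whenever $a\ge b$ there is a unique $c\in P$ with $b+c=a$, denoted $a-b$. Finally, $P$ has no nonzero additive inverses: if $a,b\in P$ and $a+b=0$ then $a=b=0$. The product $a\cdot b$ in $P$ is written $ab$. **Multisign set.** Fix an integer $s\ge 1$ and let $D=\{0,1,\dots,s\}$. The set $\Sigma^{s}$ consists of formal pairs ${}^{d}p$ with sign $d\in D$ and magnitude $p\in P$, where the sign $0$ is reserved for the element ${}^{0}0$, and ${}^{0}0$ is the only element with magnitude $0$. Thus $\Sigma^{s}=\{{}^{0}0\}\cup\{{}^{d}p: d\in\{1,\dots,s\},\ p\in P\setminus\{0\}\}$. **Addition.** For ${}^{i}a,{}^{j}b\in\Sigma^{s}$: $${}^{i}a\oplus{}^{j}b=\begin{cases}{}^{i}(a+b)&\text{if } i=j,\\ {}^{i}(a-b)&\text{if } i\ne j,\ a>b,\\ {}^{j}(b-a)&\text{if } i\neq j,\ a<b,\\ {}^{0}0&\text{if } i\ne j,\ a=b.\end{cases}$$ **Multiplication.** For ${}^{i}a,{}^{j}b\in\Sigma^{s}$: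 $${}^{i}a\otimes{}^{j}b=\begin{cases}{}^{0}0&\text{if } {}^{i}a={}^{0}0\text{ or }{}^{j}b={}^{0}0,\\ {}^{\,i+j-1-s}(ab)&\text{if both are}\neq{}^{0}0\text{ and } i+j-1>s,\\ {}^{\,i+j-1}(ab)&\text{if both are}\neq{}^{0}0\text{ and } i+j-1\le s.\end{cases}$$ **Structures.** Let $\circledast$ be a binary operation on $\Sigma^s$ and $n\ge 0$ an integer. - *Signed-associativity*: ${}^{i}a\circledast({}^{j}b\circledast{}^{k}c)=({}^{i}a\circledast{}^{j}b)\circledast{}^{k}c$ for all ${}^{i}a,{}^{j}b,{}^{k}c\in \Sigma^s$ whose signs satisfy $|\{i,j,k\}|\le 2$. - $(\Sigma^s,\circledast)$ is a *signed-monoid* if it is closed under $\circledast$, satisfies signed-associativity, and has a two-sided identity element. - $(\Sigma^s,\circledast)$ is an *abelian $n$i-signed-group* if it is closed under $\circledast$, has an identity ${}^{h}e$, every $x\neq{}^{h}e$ has exactly $n$ distinct $y$ with $x\circledast y={}^{h}e=y\circledast x$ (and ${}^{h}e$ is its own unique inverse), signed-associativity holds, and $\circledast$ is commutative. - $(\Sigma^s,\oplus,\otimes)$ is an *$n$i-signed-ring* if $(\Sigma^s,\oplus)$ is an abelian $n$i-signed-group, $(\Sigma^s,\otimes)$ is a signed-monoid, and $x\otimes(y\oplus z)=(x\otimes y)\oplus(x\otimes z)$ for all $x,y,z\in\Sigma^s$. It is *commutative* if $\otimes$ is commutative. *)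

theory Defs
  imports "HOL-Algebra.Ring" "HOL-Algebra.Order"
begin

section \<open>Magnitudes\<close>

text \<open>
  The set of magnitudes is the carrier of a ring record \<open>P\<close>, which supplies \<open>+\<close>, \<open>\<cdot>\<close>, \<open>0\<close> and \<open>1\<close>;
  no additive inverses are assumed. The order is a separate predicate, relevant only on the
  carrier.
\<close>

locale magnitudes = abelian_monoid P
  for P :: "('a, 'm) ring_scheme" (structure) +
  fixes leq :: "'a \<Rightarrow> 'a \<Rightarrow> bool" (infix \<open>\<preceq>\<close> 50)
  assumes mult_closed: "\<lbrakk>a \<in> carrier P; b \<in> carrier P\<rbrakk> \<Longrightarrow> a \<otimes> b \<in> carrier P"
    and nonzero_comm_group: "comm_group (P\<lparr>carrier := carrier P - {\<zero>}\<rparr>)"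
    and distrib_right:
      "\<lbrakk>a \<in> carrier P; b \<in> carrier P; c \<in> carrier P\<rbrakk> \<Longrightarrow> (a \<oplus> b) \<otimes> c = a \<otimes> c \<oplus> b \<otimes> c"
    and distrib_left:
      "\<lbrakk>a \<in> carrier P; b \<in> carrier P; c \<in> carrier P\<rbrakk> \<Longrightarrow> a \<otimes> (b \<oplus> c) = a \<otimes> b \<oplus> a \<otimes> c"
    and le_total_order: "total_order \<lparr>carrier = carrier P, eq = (=), le = (\<preceq>)\<rparr>"
    and translation_invariant:
      "\<lbrakk>a \<in> carrier P; b \<in> carrier P; c \<in> carrier P; a \<preceq> b\<rbrakk> \<Longrightarrow> a \<oplus> c \<preceq> b \<oplus> c"
    and add_cancel:
      "\<lbrakk>a \<in> carrier P; b \<in> carrier P; c \<in> carrier P; a \<oplus> c = b \<oplus> c\<rbrakk> \<Longrightarrow> a = b"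
    and diff_exists_unique:
      "\<lbrakk>a \<in> carrier P; b \<in> carrier P; b \<preceq> a\<rbrakk> \<Longrightarrow> \<exists>!c. c \<in> carrier P \<and> b \<oplus> c = a"
    and no_add_inverses:
      "\<lbrakk>a \<in> carrier P; b \<in> carrier P; a \<oplus> b = \<zero>\<rbrakk> \<Longrightarrow> a = \<zero> \<and> b = \<zero>"

text \<open>The difference \<open>a - b\<close>; meaningful only for \<open>b \<preceq> a\<close>.\<close>

definition mag_diff :: "('a, 'm) ring_scheme \<Rightarrow> 'a \<Rightarrow> 'a \<Rightarrow> 'a" where
  "mag_diff P a b = (THE c. c \<in> carrier P \<and> b \<oplus>\<^bsub>P\<^esub> c = a)"

section \<open>The multisign set and its operations\<close>

text \<open>A pair \<open>(d, p)\<close> has sign \<open>d\<close> and magnitude \<open>p\<close>.\<close>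

type_synonym 'a signed = "nat \<times> 'a"

abbreviation sign :: "'a signed \<Rightarrow> nat" where
  "sign \<equiv> fst"

definition multisign :: "('a, 'm) ring_scheme \<Rightarrow> nat \<Rightarrow> 'a signed set" where
  "multisign P s = insert (0, \<zero>\<^bsub>P\<^esub>) ({1..s} \<times> (carrier P - {\<zero>\<^bsub>P\<^esub>}))"

fun signed_add ::
  "('a, 'm) ring_scheme \<Rightarrow> ('a \<Rightarrow> 'a \<Rightarrow> bool) \<Rightarrow> 'a signed \<Rightarrow> 'a signed \<Rightarrow> 'a signed" where
  "signed_add P leq (i, a) (j, b) =
     (if i = j then (i, a \<oplus>\<^bsub>P\<^esub> b)
      else if leq b a \<and> a \<noteq> b then (i, mag_diff P a b)
      else if leq a b \<and> a \<noteq> b then (j, mag_diff P b a)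
      else (0, \<zero>\<^bsub>P\<^esub>))"

text \<open>
  In the last two cases both signs are at least \<open>1\<close> on \<open>multisign P s\<close>, so the truncated
  subtractions on \<open>nat\<close> are exact.
\<close>

fun signed_mult :: "('a, 'm) ring_scheme \<Rightarrow> nat \<Rightarrow> 'a signed \<Rightarrow> 'a signed \<Rightarrow> 'a signed" where
  "signed_mult P s (i, a) (j, b) =
     (if (i, a) = (0, \<zero>\<^bsub>P\<^esub>) \<or> (j, b) = (0, \<zero>\<^bsub>P\<^esub>) then (0, \<zero>\<^bsub>P\<^esub>)
      else if i + j - 1 > s then (i + j - 1 - s, a \<otimes>\<^bsub>P\<^esub> b)
      else (i + j - 1, a \<otimes>\<^bsub>P\<^esub> b))"

section \<open>Signed structures\<close>

definition closed_under :: "'b set \<Rightarrow> ('b \<Rightarrow> 'b \<Rightarrow> 'b) \<Rightarrow> bool" where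
  "closed_under S f \<longleftrightarrow> (\<forall>x\<in>S. \<forall>y\<in>S. f x y \<in> S)"

definition commutative_on :: "'b set \<Rightarrow> ('b \<Rightarrow> 'b \<Rightarrow> 'b) \<Rightarrow> bool" where
  "commutative_on S f \<longleftrightarrow> (\<forall>x\<in>S. \<forall>y\<in>S. f x y = f y x)"

definition is_identity :: "'b set \<Rightarrow> ('b \<Rightarrow> 'b \<Rightarrow> 'b) \<Rightarrow> 'b \<Rightarrow> bool" where
  "is_identity S f e \<longleftrightarrow> e \<in> S \<and> (\<forall>x\<in>S. f e x = x \<and> f x e = x)"

definition inverses :: "'b set \<Rightarrow> ('b \<Rightarrow> 'b \<Rightarrow> 'b) \<Rightarrow> 'b \<Rightarrow> 'b \<Rightarrow> 'b set" where
  "inverses S f e x = {y \<in> S. f x y = e \<and> f y x = e}"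

definition signed_assoc ::
  "'a signed set \<Rightarrow> ('a signed \<Rightarrow> 'a signed \<Rightarrow> 'a signed) \<Rightarrow> bool" where
  "signed_assoc S f \<longleftrightarrow>
     (\<forall>x\<in>S. \<forall>y\<in>S. \<forall>z\<in>S. card {sign x, sign y, sign z} \<le> 2 \<longrightarrow> f x (f y z) = f (f x y) z)"

definition signed_monoid ::
  "'a signed set \<Rightarrow> ('a signed \<Rightarrow> 'a signed \<Rightarrow> 'a signed) \<Rightarrow> bool" where
  "signed_monoid S f \<longleftrightarrow> closed_under S f \<and> signed_assoc S f \<and> (\<exists>e. is_identity S f e)"

text \<open>Finiteness is explicit because \<open>card\<close> of an infinite set is \<open>0\<close>, and \<open>n = 0\<close> is allowed.\<close>

definition abelian_ni_signed_group ::
  "nat \<Rightarrow> 'a signed set \<Rightarrow> ('a signed \<Rightarrow> 'a signed \<Rightarrow> 'a signed) \<Rightarrow> bool" where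
  "abelian_ni_signed_group n S f \<longleftrightarrow>
     closed_under S f \<and>
     (\<exists>e. is_identity S f e \<and>
          (\<forall>x\<in>S. x \<noteq> e \<longrightarrow> finite (inverses S f e x) \<and> card (inverses S f e x) = n) \<and>
          inverses S f e e = {e}) \<and>
     signed_assoc S f \<and>
     commutative_on S f"

definition ni_signed_ring ::
  "nat \<Rightarrow> 'a signed set \<Rightarrow> ('a signed \<Rightarrow> 'a signed \<Rightarrow> 'a signed) \<Rightarrow>
   ('a signed \<Rightarrow> 'a signed \<Rightarrow> 'a signed) \<Rightarrow> bool" where
  "ni_signed_ring n S p m \<longleftrightarrow>
     abelian_ni_signed_group n S p \<and>
     signed_monoid S m \<and>
     (\<forall>x\<in>S. \<forall>y\<in>S. \<forall>z\<in>S. m x (p y z) = p (m x y) (m x z))"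

definition commutative_ni_signed_ring ::
  "nat \<Rightarrow> 'a signed set \<Rightarrow> ('a signed \<Rightarrow> 'a signed \<Rightarrow> 'a signed) \<Rightarrow>
   ('a signed \<Rightarrow> 'a signed \<Rightarrow> 'a signed) \<Rightarrow> bool" where
  "commutative_ni_signed_ring n S p m \<longleftrightarrow>
     ni_signed_ring n S p m \<and> commutative_on S m"

end

theory Submission
  imports Defs
begin

text \<open>
  By totality of the order, any two magnitudes are equal or differ by a non-zero summand, so the
  order can be eliminated: addition of opposite signs cancels the common summand. Fix a sign
  \<open>i\<close>, count the magnitudes of sign \<open>i\<close> positively and all others negatively. On
  elements with signs in \<open>{0, i, j}\<close> this is an injection into the group of differences of
  \<open>P\<close>, written below without subtraction, and it is additive; this gives
  signed-associativity. Left multiplication by a non-zero element permutes the non-zero signs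
  and preserves sums and non-zero summands of magnitudes, hence it commutes with addition.
\<close>

section \<open>Cyclic arithmetic of the non-zero signs\<close>

text \<open>On \<open>{1..s}\<close> this is addition in the cyclic group of order \<open>s\<close>,
  transported along \<open>i\<close> to \<open>i - 1\<close>; hence \<open>1\<close> is
  neutral.\<close>

definition sign_mult :: "nat \<Rightarrow> nat \<Rightarrow> nat \<Rightarrow> nat" where
  "sign_mult s i j = (if i + j - 1 > s then i + j - 1 - s else i + j - 1)"

lemma sign_mult_range:
  "\<lbrakk>i \<in> {1..s}; j \<in> {1..s}\<rbrakk> \<Longrightarrow> sign_mult s i j \<in> {1..s}"
  by (auto simp: sign_mult_def)

lemma sign_mult_comm: "sign_mult s i j = sign_mult s j i"
  by (simp add: sign_mult_def add.commute)

lemma sign_mult_assoc: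
  "\<lbrakk>i \<in> {1..s}; j \<in> {1..s}; k \<in> {1..s}\<rbrakk>
    \<Longrightarrow> sign_mult s i (sign_mult s j k) = sign_mult s (sign_mult s i j) k"
  by (auto simp: sign_mult_def)

lemma sign_mult_one: "i \<in> {1..s} \<Longrightarrow> sign_mult s 1 i = i"
  by (auto simp: sign_mult_def)

text \<open>Translation in a group is injective. Distributivity needs this, so that different signs
  stay different after multiplication.\<close>

lemma sign_mult_inject:
  "\<lbrakk>i \<in> {1..s}; j \<in> {1..s}; k \<in> {1..s}\<rbrakk>
    \<Longrightarrow> sign_mult s i j = sign_mult s i k \<longleftrightarrow> j = k"
  by (auto simp: sign_mult_def split: if_splits)

lemma card_le_two_subset:
  assumes "card {x, y, z} \<le> 2"
  obtains i j where "{x, y, z} \<subseteq> {i, j}"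
proof -
  have "x = y \<or> y = z \<or> x = z"
    using assms by (rule_tac ccontr) simp
  then show thesis using that by blast
qed

context magnitudes
begin

section \<open>Order, cancellation and differences of magnitudes\<close>

lemma leq_antisym:
  "\<lbrakk>a \<preceq> b; b \<preceq> a; a \<in> carrier P; b \<in> carrier P\<rbrakk> \<Longrightarrow> a = b"
  using partial_order.le_antisym[OF total_order.axioms(1)[OF le_total_order], of a b] by simp

lemma leq_total: "\<lbrakk>a \<in> carrier P; b \<in> carrier P\<rbrakk> \<Longrightarrow> a \<preceq> b \<or> b \<preceq> a"
  using total_order.total_order_total[OF le_total_order] by simp

text \<open>If \<open>a \<preceq> \<zero>\<close>, then \<open>a \<oplus> c = \<zero>\<close> for
  some \<open>c\<close>, and the absence of additive inverses forces
  \<open>a = \<zero>\<close>.\<close>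

lemma zero_leq: "a \<in> carrier P \<Longrightarrow> \<zero> \<preceq> a"
  using leq_total[of "\<zero>" a] diff_exists_unique[of "\<zero>" a] no_add_inverses by (metis zero_closed)

lemma leq_add: "\<lbrakk>a \<in> carrier P; c \<in> carrier P\<rbrakk> \<Longrightarrow> a \<preceq> a \<oplus> c"
  using translation_invariant[of "\<zero>" c a] zero_leq[of c] by (simp add: a_comm)

lemma mag_add_left_cancel:
  "\<lbrakk>a \<in> carrier P; b \<in> carrier P; c \<in> carrier P\<rbrakk> \<Longrightarrow> c \<oplus> a = c \<oplus> b \<longleftrightarrow> a = b"
  using add_cancel[of a b c] a_comm[of c a] a_comm[of c b] by argo

lemma add_eq_self: "\<lbrakk>a \<in> carrier P; c \<in> carrier P\<rbrakk> \<Longrightarrow> a \<oplus> c = a \<longleftrightarrow> c = \<zero>"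
  using mag_add_left_cancel[of c "\<zero>" a] by simp

lemma add_eq_zero:
  "\<lbrakk>a \<in> carrier P; c \<in> carrier P\<rbrakk> \<Longrightarrow> a \<oplus> c = \<zero> \<longleftrightarrow> a = \<zero> \<and> c = \<zero>"
  using no_add_inverses[of a c] by auto

lemma mag_diff_add: "\<lbrakk>a \<in> carrier P; c \<in> carrier P\<rbrakk> \<Longrightarrow> mag_diff P (a \<oplus> c) a = c"
  unfolding mag_diff_def by (rule the_equality) (auto simp: mag_add_left_cancel)

lemma mag_trichotomy:
  assumes "a \<in> carrier P" "b \<in> carrier P"
  obtains (eq) "a = b"
    | (less) c where "c \<in> carrier P" "c \<noteq> \<zero>" "b = a \<oplus> c"
    | (greater) c where "c \<in> carrier P" "c \<noteq> \<zero>" "a = b \<oplus> c"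
  using leq_total[OF assms] diff_exists_unique[of a b] diff_exists_unique[of b a] assms r_zero
  by metis

section \<open>Order-free rules for signed addition\<close>

abbreviation mzero :: "'a signed" where "mzero \<equiv> (0, \<zero>)"

abbreviation sadd :: "'a signed \<Rightarrow> 'a signed \<Rightarrow> 'a signed" (infixl \<open>\<boxplus>\<close> 65)
  where "x \<boxplus> y \<equiv> signed_add P (\<preceq>) x y"

lemma signed_add_same: "(i, a) \<boxplus> (i, b) = (i, a \<oplus> b)"
  by simp

lemma signed_add_eq: "i \<noteq> j \<Longrightarrow> (i, a) \<boxplus> (j, a) = mzero"
  by simp

lemma signed_add_greater:
  "\<lbrakk>i \<noteq> j; a \<in> carrier P; c \<in> carrier P; c \<noteq> \<zero>\<rbrakk> \<Longrightarrow> (i, a \<oplus> c) \<boxplus> (j, a) = (i, c)"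
  by (simp add: leq_add add_eq_self mag_diff_add)

lemma signed_add_less:
  assumes "i \<noteq> j" "a \<in> carrier P" "c \<in> carrier P" "c \<noteq> \<zero>"
  shows "(i, a) \<boxplus> (j, a \<oplus> c) = (j, c)"
proof -
  have ne: "a \<noteq> a \<oplus> c"
    using assms add_eq_self by metis
  \<comment> \<open>\<open>signed_add\<close> tests first whether the left magnitude is the greater
    one, so that branch has to be refuted.\<close>
  moreover have "\<not> a \<oplus> c \<preceq> a"
    using ne assms leq_antisym[of a "a \<oplus> c"] leq_add by auto
  ultimately show ?thesis
    using assms by (simp add: leq_add mag_diff_add)
qed

lemmas signed_add_rules =
  signed_add_same signed_add_eq signed_add_greater signed_add_less

lemma multisign_cases:
  assumes "x \<in> multisign P s"
  obtains (zero) "x = mzero"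
    | (nonzero) i a where "x = (i, a)" "i \<in> {1..s}" "a \<in> carrier P" "a \<noteq> \<zero>"
  using assms unfolding multisign_def by blast

lemma multisign_memb [simp]: "mzero \<in> multisign P s"
  "\<lbrakk>i \<in> {1..s}; a \<in> carrier P; a \<noteq> \<zero>\<rbrakk> \<Longrightarrow> (i, a) \<in> multisign P s"
  by (auto simp: multisign_def)

lemma signed_add_zero:
  assumes "x \<in> multisign P s"
  shows "mzero \<boxplus> x = x" "x \<boxplus> mzero = x"
  using assms
proof (atomize (full), cases rule: multisign_cases)
  case (nonzero i a)
  then show "mzero \<boxplus> x = x \<and> x \<boxplus> mzero = x"
    \<comment> \<open>Sign \<open>0\<close> differs from \<open>i\<close>, so \<open>mzero\<close>
      falls under the rules for different signs, with common summand \<open>\<zero>\<close>.\<close>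
    using signed_add_less[of 0 i "\<zero>" a] signed_add_greater[of i 0 "\<zero>" a]
    by (simp del: signed_add.simps)
qed simp

section \<open>Formal differences and signed-associativity\<close>

definition pos_part :: "nat \<Rightarrow> 'a signed \<Rightarrow> 'a" where
  "pos_part i x = (if sign x = i then snd x else \<zero>)"

definition neg_part :: "nat \<Rightarrow> 'a signed \<Rightarrow> 'a" where
  "neg_part i x = (if sign x = i then \<zero> else snd x)"

lemma parts_closed [simp]:
  assumes "x \<in> multisign P s"
  shows "pos_part i x \<in> carrier P" "neg_part i x \<in> carrier P"
  using assms by (auto simp: pos_part_def neg_part_def multisign_def)

text \<open>The last equation is additivity of the formal difference \<open>pos_part\<close> minus
  \<open>neg_part\<close>. Two different non-zero signs in \<open>{0, i, j}\<close> include
  \<open>i\<close>, so cancelling magnitudes count on opposite sides. The bound on the sign of the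
  sum lets the lemma be iterated.\<close>

lemma signed_add_parts:
  assumes "x \<in> multisign P s" "y \<in> multisign P s" "{sign x, sign y} \<subseteq> {0, i, j}"
  shows "x \<boxplus> y \<in> multisign P s" "sign (x \<boxplus> y) \<in> {0, i, j}"
    "pos_part i x \<oplus> pos_part i y \<oplus> neg_part i (x \<boxplus> y)
      = neg_part i x \<oplus> neg_part i y \<oplus> pos_part i (x \<boxplus> y)"
proof -
  have "x \<boxplus> y \<in> multisign P s \<and> sign (x \<boxplus> y) \<in> {0, i, j} \<and>
    pos_part i x \<oplus> pos_part i y \<oplus> neg_part i (x \<boxplus> y)
      = neg_part i x \<oplus> neg_part i y \<oplus> pos_part i (x \<boxplus> y)"
    using assms(1)
  proof (cases rule: multisign_cases)
    case zero
    then show ?thesis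
      using assms signed_add_zero[OF assms(2)]
      by (auto simp: pos_part_def neg_part_def multisign_def)
  next
    case x: (nonzero k a)
    show ?thesis
      using assms(2)
    proof (cases rule: multisign_cases)
      case zero
      then show ?thesis
        using assms signed_add_zero[OF assms(1)]
        by (auto simp: pos_part_def neg_part_def multisign_def)
    next
      case y: (nonzero l b)
      show ?thesis
      proof (cases "k = l")
        case True
        then show ?thesis
          using x y assms by (auto simp: pos_part_def neg_part_def add_eq_zero)
      next
        case False
        show ?thesis
          using x(3) y(3)
        proof (cases rule: mag_trichotomy)
          case eq
          with False x y assms show ?thesis
            by (auto simp: pos_part_def neg_part_def signed_add_rules simp del: signed_add.simps)
        next
          case (less c)
          with False x y assms show ?thesis
            by (auto simp: pos_part_def neg_part_def signed_add_rules simp del: signed_add.simps)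
        next
          case (greater c)
          with False x y assms show ?thesis
            by (auto simp: pos_part_def neg_part_def signed_add_rules simp del: signed_add.simps)
        qed
      qed
    qed
  qed
  then show "x \<boxplus> y \<in> multisign P s" "sign (x \<boxplus> y) \<in> {0, i, j}"
    "pos_part i x \<oplus> pos_part i y \<oplus> neg_part i (x \<boxplus> y)
      = neg_part i x \<oplus> neg_part i y \<oplus> pos_part i (x \<boxplus> y)"
    by blast+
qed

lemma signed_add_closed:
  "\<lbrakk>x \<in> multisign P s; y \<in> multisign P s\<rbrakk> \<Longrightarrow> x \<boxplus> y \<in> multisign P s"
  \<comment> \<open>The sign bound is no restriction for two elements: their own signs serve as
    \<open>i\<close> and \<open>j\<close>.\<close>
  by (rule signed_add_parts(1)[where i = "sign x" and j = "sign y"]) auto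

text \<open>If the signs are equal, the equation compares magnitudes. Otherwise it says that a sum
  of the two magnitudes, at least one of them non-zero, is \<open>\<zero>\<close>, which is
  impossible.\<close>

lemma parts_inject:
  assumes "x \<in> multisign P s" "y \<in> multisign P s" "{sign x, sign y} \<subseteq> {0, i, j}"
    and "pos_part i x \<oplus> neg_part i y = neg_part i x \<oplus> pos_part i y"
  shows "x = y"
  using assms(1,2)
  by (elim multisign_cases; use assms(3,4) in
      \<open>auto simp: pos_part_def neg_part_def add_eq_zero dest!: sym[of "\<zero>"] split: if_splits\<close>)

text \<open>Associativity for the differences \<open>pk - qk\<close>: here \<open>u - v\<close> and
  \<open>u' - v'\<close> are the inner sums, \<open>p - q\<close> and \<open>p' - q'\<close> the
  outer ones.\<close>

lemma difference_eq_assoc: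
  assumes car: "p \<in> carrier P" "q \<in> carrier P" "p1 \<in> carrier P" "q1 \<in> carrier P"
      "p2 \<in> carrier P" "q2 \<in> carrier P" "p3 \<in> carrier P" "q3 \<in> carrier P"
      "p' \<in> carrier P" "q' \<in> carrier P" "u \<in> carrier P" "v \<in> carrier P"
      "u' \<in> carrier P" "v' \<in> carrier P"
    and "p2 \<oplus> p3 \<oplus> v = q2 \<oplus> q3 \<oplus> u" "p1 \<oplus> u \<oplus> q = q1 \<oplus> v \<oplus> p"
    and "p1 \<oplus> p2 \<oplus> v' = q1 \<oplus> q2 \<oplus> u'" "u' \<oplus> p3 \<oplus> q' = v' \<oplus> q3 \<oplus> p'"
  shows "p \<oplus> q' = q \<oplus> p'"
proof -
  \<comment> \<open>The four equations are added, the last two reversed; \<open>t\<close> collects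
    the terms common to both sides and is cancelled at the end.\<close>
  define t where "t = (p1 \<oplus> p2 \<oplus> p3) \<oplus> (q1 \<oplus> q2 \<oplus> q3) \<oplus> (u \<oplus> v \<oplus> u' \<oplus> v')"
  have "t \<oplus> (q \<oplus> p') = (p2 \<oplus> p3 \<oplus> v) \<oplus> (p1 \<oplus> u \<oplus> q)
      \<oplus> (q1 \<oplus> q2 \<oplus> u') \<oplus> (v' \<oplus> q3 \<oplus> p')"
    using car unfolding t_def by (simp add: a_ac)
  also have "\<dots> = (q2 \<oplus> q3 \<oplus> u) \<oplus> (q1 \<oplus> v \<oplus> p)
      \<oplus> (p1 \<oplus> p2 \<oplus> v') \<oplus> (u' \<oplus> p3 \<oplus> q')"
    by (simp only: assms)
  also have "\<dots> = t \<oplus> (p \<oplus> q')"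
    using car unfolding t_def by (simp add: a_ac)
  finally show ?thesis
    using car mag_add_left_cancel[of "q \<oplus> p'" "p \<oplus> q'" t] by (simp add: t_def)
qed

lemma signed_add_signed_assoc: "signed_assoc (multisign P s) (\<boxplus>)"
  unfolding signed_assoc_def
proof (intro ballI impI)
  fix x y z
  assume mem: "x \<in> multisign P s" "y \<in> multisign P s" "z \<in> multisign P s"
    and "card {sign x, sign y, sign z} \<le> 2"
  then obtain i j where ij: "{sign x, sign y, sign z} \<subseteq> {i, j}"
    by (rule_tac card_le_two_subset)
  then have sub: "{sign x, sign y} \<subseteq> {0, i, j}" "{sign y, sign z} \<subseteq> {0, i, j}"
    by auto
  note yz = signed_add_parts[OF mem(2,3) sub(2)] and xy = signed_add_parts[OF mem(1,2) sub(1)]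
  have sub': "{sign x, sign (y \<boxplus> z)} \<subseteq> {0, i, j}" "{sign (x \<boxplus> y), sign z} \<subseteq> {0, i, j}"
    using ij yz(2) xy(2) by auto
  note x_yz = signed_add_parts[OF mem(1) yz(1) sub'(1)]
    and xy_z = signed_add_parts[OF xy(1) mem(3) sub'(2)]
  show "x \<boxplus> (y \<boxplus> z) = (x \<boxplus> y) \<boxplus> z"
  proof (rule parts_inject[OF x_yz(1) xy_z(1)])
    show "{sign (x \<boxplus> (y \<boxplus> z)), sign ((x \<boxplus> y) \<boxplus> z)} \<subseteq> {0, i, j}"
      using x_yz(2) xy_z(2) by (simp only: insert_subset empty_subsetI simp_thms)
    show "pos_part i (x \<boxplus> (y \<boxplus> z)) \<oplus> neg_part i ((x \<boxplus> y) \<boxplus> z)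
        = neg_part i (x \<boxplus> (y \<boxplus> z)) \<oplus> pos_part i ((x \<boxplus> y) \<boxplus> z)"
      by (rule difference_eq_assoc[OF _ _ _ _ _ _ _ _ _ _ _ _ _ _ yz(3) x_yz(3) xy(3) xy_z(3)])
        (use mem yz(1) xy(1) x_yz(1) xy_z(1) in simp_all)
  qed
qed

section \<open>Commutativity and counting of additive inverses\<close>

text \<open>Exchanging the arguments exchanges the two strict comparisons, which antisymmetry makes
  mutually exclusive.\<close>

lemma signed_add_comm:
  assumes "x \<in> multisign P s" "y \<in> multisign P s"
  shows "x \<boxplus> y = y \<boxplus> x"
proof -
  obtain i a j b where "x = (i, a)" "y = (j, b)" "a \<in> carrier P" "b \<in> carrier P"
    using assms zero_closed by (elim multisign_cases) blast+
  then show ?thesis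
    using leq_antisym by (auto simp: a_comm)
qed

text \<open>Equal signs give a non-zero sum, and unequal magnitudes leave a non-zero remainder. The
  signs other than \<open>i\<close> account for the \<open>s - 1\<close> inverses.\<close>

lemma signed_add_eq_zero_iff:
  assumes "i \<in> {1..s}" "a \<in> carrier P" "a \<noteq> \<zero>" "y \<in> multisign P s"
  shows "(i, a) \<boxplus> y = mzero \<longleftrightarrow> y \<in> ({1..s} - {i}) \<times> {a}"
  using assms(4)
proof (cases rule: multisign_cases)
  case zero
  then show ?thesis
    using assms signed_add_zero(2)[of "(i, a)" s] by auto
next
  case (nonzero j b)
  show ?thesis
    using assms(2) nonzero(3)
  proof (cases rule: mag_trichotomy)
    case eq
    with assms nonzero show ?thesis by (cases "i = j") auto
  next
    case (less c)
    with assms nonzero show ?thesis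
      by (cases "i = j")
        (auto simp: signed_add_rules add_eq_zero add_eq_self simp del: signed_add.simps)
  next
    case (greater c)
    then have "b \<noteq> b \<oplus> c"
      using add_eq_self[of b c] nonzero(3) by metis
    with greater assms nonzero show ?thesis
      by (cases "i = j")
        (auto simp: signed_add_rules add_eq_zero simp del: signed_add.simps)
  qed
qed

lemma inverses_nonzero:
  assumes "i \<in> {1..s}" "a \<in> carrier P" "a \<noteq> \<zero>"
  shows "inverses (multisign P s) (\<boxplus>) mzero (i, a) = ({1..s} - {i}) \<times> {a}"
proof -
  have "inverses (multisign P s) (\<boxplus>) mzero (i, a)
      = {y \<in> multisign P s. (i, a) \<boxplus> y = mzero}"
    using assms signed_add_comm[of "(i, a)" s] by (auto simp: inverses_def)
  also have "\<dots> = ({1..s} - {i}) \<times> {a}"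
    using assms signed_add_eq_zero_iff[OF assms] by auto
  finally show ?thesis .
qed

lemma inverses_zero: "inverses (multisign P s) (\<boxplus>) mzero mzero = {mzero}"
  using signed_add_zero by (auto simp: inverses_def simp del: signed_add.simps)

lemma signed_add_abelian_group:
  "abelian_ni_signed_group (s - 1) (multisign P s) (\<boxplus>)"
proof -
  have "finite (inverses (multisign P s) (\<boxplus>) mzero x) \<and>
      card (inverses (multisign P s) (\<boxplus>) mzero x) = s - 1"
    if "x \<in> multisign P s" "x \<noteq> mzero" for x
    using that by (elim multisign_cases) (simp_all add: inverses_nonzero)
  moreover have "is_identity (multisign P s) (\<boxplus>) mzero"
    using signed_add_zero by (auto simp: is_identity_def simp del: signed_add.simps)
  ultimately show ?thesis
    unfolding abelian_ni_signed_group_def closed_under_def commutative_on_def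
    using signed_add_closed signed_add_signed_assoc signed_add_comm inverses_zero by blast
qed

section \<open>The commutative monoid under multiplication\<close>

interpretation nonzero: comm_group "P\<lparr>carrier := carrier P - {\<zero>}\<rparr>"
  rewrites "carrier (P\<lparr>carrier := carrier P - {\<zero>}\<rparr>) = carrier P - {\<zero>}"
    and "mult (P\<lparr>carrier := carrier P - {\<zero>}\<rparr>) = mult P"
    and "one (P\<lparr>carrier := carrier P - {\<zero>}\<rparr>) = one P"
  by (rule nonzero_comm_group) simp_all

lemma mult_nonzero:
  "\<lbrakk>a \<in> carrier P; a \<noteq> \<zero>; b \<in> carrier P; b \<noteq> \<zero>\<rbrakk> \<Longrightarrow> a \<otimes> b \<noteq> \<zero>"
  using nonzero.m_closed by simp

abbreviation smult :: "nat \<Rightarrow> 'a signed \<Rightarrow> 'a signed \<Rightarrow> 'a signed"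
  where "smult s x y \<equiv> signed_mult P s x y"

lemma signed_mult_zero: "smult s mzero x = mzero" "smult s x mzero = mzero"
  by (cases x; simp)+

lemma signed_mult_nonzero:
  "\<lbrakk>a \<noteq> \<zero>; b \<noteq> \<zero>\<rbrakk> \<Longrightarrow> smult s (i, a) (j, b) = (sign_mult s i j, a \<otimes> b)"
  by (simp add: sign_mult_def)

lemmas signed_mult_rules = signed_mult_zero signed_mult_nonzero

lemma signed_mult_closed:
  "\<lbrakk>x \<in> multisign P s; y \<in> multisign P s\<rbrakk> \<Longrightarrow> smult s x y \<in> multisign P s"
  by (elim multisign_cases)
    (simp_all add: signed_mult_rules mult_nonzero mult_closed sign_mult_range
      del: signed_mult.simps One_nat_def atLeastAtMost_iff)

lemma signed_mult_comm:
  "\<lbrakk>x \<in> multisign P s; y \<in> multisign P s\<rbrakk> \<Longrightarrow> smult s x y = smult s y x"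
  by (elim multisign_cases)
    (simp_all add: signed_mult_rules nonzero.m_comm sign_mult_comm del: signed_mult.simps)

lemma signed_mult_assoc:
  "\<lbrakk>x \<in> multisign P s; y \<in> multisign P s; z \<in> multisign P s\<rbrakk>
    \<Longrightarrow> smult s x (smult s y z) = smult s (smult s x y) z"
  by (elim multisign_cases)
    (simp_all add: signed_mult_rules mult_nonzero nonzero.m_assoc sign_mult_assoc
      del: signed_mult.simps One_nat_def atLeastAtMost_iff)

lemma signed_mult_one:
  "x \<in> multisign P s \<Longrightarrow> smult s (1, \<one>) x = x"
  using nonzero.one_closed
  by (elim multisign_cases)
    (simp_all add: signed_mult_rules sign_mult_one del: signed_mult.simps One_nat_def atLeastAtMost_iff)

lemma signed_mult_monoid:
  assumes "s \<ge> 1"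
  shows "signed_monoid (multisign P s) (smult s)"
proof -
  \<comment> \<open>This is where \<open>s \<ge> 1\<close> enters: it makes \<open>1\<close> an
    available sign.\<close>
  have one: "(1, \<one>) \<in> multisign P s"
    using assms nonzero.one_closed by simp
  then have "is_identity (multisign P s) (smult s) (1, \<one>)"
    unfolding is_identity_def using signed_mult_one signed_mult_comm by metis
  then show ?thesis
    unfolding signed_monoid_def closed_under_def signed_assoc_def
    using signed_mult_closed signed_mult_assoc by blast
qed

section \<open>Distributivity\<close>

lemma signed_mult_distrib:
  assumes "x \<in> multisign P s" "y \<in> multisign P s" "z \<in> multisign P s"
  shows "smult s x (y \<boxplus> z) = smult s x y \<boxplus> smult s x z"
  using assms(1)
proof (cases rule: multisign_cases)
  case zero
  then show ?thesis by (simp add: signed_mult_rules del: signed_mult.simps)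
next
  case x: (nonzero k c)
  show ?thesis
    using assms(2)
  proof (cases rule: multisign_cases)
    case zero
    then show ?thesis
      using assms signed_add_zero(1)[OF assms(3)] signed_add_zero(1)[OF signed_mult_closed]
      by (simp add: signed_mult_zero del: signed_mult.simps signed_add.simps)
  next
    case y: (nonzero i a)
    show ?thesis
      using assms(3)
    proof (cases rule: multisign_cases)
      case zero
      then show ?thesis
        using assms signed_add_zero(2)[OF assms(2)] signed_add_zero(2)[OF signed_mult_closed]
        by (simp add: signed_mult_zero del: signed_mult.simps signed_add.simps)
    next
      case z: (nonzero j b)
      show ?thesis
      proof (cases "i = j")
        case True
        with x y z show ?thesis
          by (simp add: signed_add_same signed_mult_nonzero add_eq_zero distrib_left
              del: signed_add.simps signed_mult.simps)
      next
        case False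
        \<comment> \<open>Both sides therefore use the rules for different signs.\<close>
        then have signs: "sign_mult s k i \<noteq> sign_mult s k j"
          using x y z sign_mult_inject by blast
        show ?thesis
          using y(3) z(3)
        proof (cases rule: mag_trichotomy)
          case eq
          with False signs x y z show ?thesis
            by (simp add: signed_add_eq signed_mult_rules del: signed_add.simps signed_mult.simps)
        next
          \<comment> \<open>Multiplying by \<open>c\<close> turns the remainder \<open>d\<close>
            into \<open>c \<otimes> d\<close>, again non-zero, so the same addition rule evaluates
            both sides.\<close>
          case (less d)
          with False signs x y z show ?thesis
            by (simp add: signed_add_less signed_mult_nonzero distrib_left mult_closed mult_nonzero
                del: signed_add.simps signed_mult.simps)
        next
          case (greater d)
          with False signs x y z show ?thesis
            by (simp add: signed_add_greater signed_mult_nonzero distrib_left mult_closed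
                mult_nonzero del: signed_add.simps signed_mult.simps)
        qed
      qed
    qed
  qed
qed

end

theorem theorem3p26:
  fixes P :: "('a, 'm) ring_scheme"
    and leq :: "'a \<Rightarrow> 'a \<Rightarrow> bool"
    and s :: nat
  assumes "magnitudes P leq"
    and "s \<ge> 1"
  shows "commutative_ni_signed_ring (s - 1) (multisign P s) (signed_add P leq) (signed_mult P s)"
proof -
  interpret magnitudes P leq by (rule assms(1))
  show ?thesis
    unfolding commutative_ni_signed_ring_def ni_signed_ring_def commutative_on_def
    using signed_add_abelian_group signed_mult_monoid[OF assms(2)] signed_mult_distrib
      signed_mult_comm by blast
qed

end
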